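(* Let $p$ be a prime number. Let $v,t,k$ be non-negative integers with base-$p$ expansions $k=\sum_{i=0}^{k(p)} k_i p^i$ and $t=\sum_{i=0}^{t(p)} t_i p^i$ (digits $0\le k_i,t_i\le p-1$, leading digits nonzero when the number is nonzero). Let $V$ be a set of $v$ elements with $t\leq \min(k,v-k)$, and let $U$ and $U'$ be sets of $t$-element subsets of $V$. Assume that for every $k$-element subset $K$ of $V$, the number of elements of $U$ contained in $K$ is congruent modulo $p$ to the number of elements of $U'$ contained in $K$. 1) If $k_i=t_i$ for all $i<t(p)$ and $k_{t(p)}\geq t_{t(p)}$, then $U=U'$. 2) If $t=t_{t(p)}p^{t(p)}$ and $k=\sum_{i=t(p)+1}^{k(p)} k_i p^i$, then either $U=U'$, or one of the sets $U,U'$ is the set of all $t$-element subsets of $V$ and the other is empty, or (this last case only when $p=2$) for every $t$-element subset $T$ of $V$, $T\in U$ if and only if $T\notin U'$.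
   Context: For a positive integer $n$, $n=\sum_{i=0}^{n(p)} n_i p^i$ denotes its expansion in base $p$, with $n_{n(p)}\neq 0$ when $n\neq 0$. *)

theory Defs
  imports "HOL-Number_Theory.Cong" "HOL-Computational_Algebra.Primes"
begin

text \<open>
  \<open>base_expansion p n m d\<close>: the digits \<open>d 0, \<dots>, d m\<close> form the base-\<open>p\<close> expansion of \<open>n\<close>,
  with leading index \<open>m\<close>, so that \<open>m = n(p)\<close> and \<open>d i = n\<^sub>i\<close>.
  For \<open>n \<noteq> 0\<close> this determines \<open>m\<close> and \<open>d\<close> on \<open>{..m}\<close>; for \<open>n = 0\<close> all digits are zero
  and \<open>m\<close> is arbitrary, which includes the usual choice \<open>m = 0\<close>.
  Values of \<open>d\<close> above \<open>m\<close> are irrelevant.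
\<close>

definition base_expansion :: "nat \<Rightarrow> nat \<Rightarrow> nat \<Rightarrow> (nat \<Rightarrow> nat) \<Rightarrow> bool" where
  "base_expansion p n m d \<longleftrightarrow>
     n = (\<Sum>i=0..m. d i * p ^ i) \<and> (\<forall>i\<le>m. d i \<le> p - 1) \<and> (n \<noteq> 0 \<longrightarrow> d m \<noteq> 0)"

end

theory Submission
  imports Defs
begin

text \<open>
  Let \<open>f\<close> be the difference of the indicator functions of \<open>U\<close> and \<open>U'\<close>; its sum over the
  \<open>t\<close>-subsets of any \<open>k\<close>-set vanishes modulo \<open>p\<close>. For distinct points \<open>x\<close>, \<open>y\<close> the function
  \<open>g S = f (S \<union> {x}) - f (S \<union> {y})\<close> satisfies the same hypothesis on \<open>V - {x, y}\<close> with
  \<open>(t - 1, k - 1)\<close> in place of \<open>(t, k)\<close>, so by induction \<open>f\<close> is constant modulo \<open>p\<close> as soon as no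
  \<open>(k - i) choose (t - i)\<close> with \<open>1 \<le> i \<le> t\<close> is divisible by \<open>p\<close>, and a constant \<open>f\<close> is zero
  if \<open>p\<close> does not divide \<open>k choose t\<close> either. The digit conditions guarantee this for
  all \<open>i \<ge> 0\<close> in part 1, and for all \<open>i \<ge> 1\<close> in part 2.
\<close>

section \<open>Functions on \<open>t\<close>-subsets whose sums over \<open>k\<close>-sets vanish
  modulo \<open>p\<close>\<close>

lemma cong_const_sum_subsets:
  fixes f :: "'a set \<Rightarrow> int"
  assumes "finite K" "card K = k"
    and "\<And>T. T \<subseteq> K \<Longrightarrow> card T = t \<Longrightarrow> [f T = c] (mod m)"
  shows "[(\<Sum>T | T \<subseteq> K \<and> card T = t. f T) = int (k choose t) * c] (mod m)"
proof -
  have "[(\<Sum>T | T \<subseteq> K \<and> card T = t. f T) = (\<Sum>T | T \<subseteq> K \<and> card T = t. c)] (mod m)"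
    using assms(3) by (intro cong_sum) auto
  then show ?thesis
    using n_subsets[OF assms(1), of t] assms(2) by simp
qed

text \<open>A single \<open>k\<close>-set suffices: by constancy its sum is
  \<open>(k choose t) * f T\<close>, and the prime \<open>p\<close> does not divide the binomial
  factor.\<close>

lemma dvd_of_cong_const:
  fixes f :: "'a set \<Rightarrow> int"
  assumes "prime p" "finite V" "t \<le> k" "k \<le> card V" "\<not> p dvd k choose t"
    and sum: "\<And>K. K \<subseteq> V \<Longrightarrow> card K = k \<Longrightarrow>
                [(\<Sum>T | T \<subseteq> K \<and> card T = t. f T) = 0] (mod int p)"
    and const: "\<And>T T'. \<lbrakk>T \<subseteq> V; card T = t; T' \<subseteq> V; card T' = t\<rbrakk> \<Longrightarrow> [f T = f T'] (mod int p)"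
    and T: "T \<subseteq> V" "card T = t"
  shows "[f T = 0] (mod int p)"
proof -
  obtain K where K: "K \<subseteq> V" "card K = k"
    using assms(4) obtain_subset_with_card_n by metis
  have "[(\<Sum>T | T \<subseteq> K \<and> card T = t. f T) = int (k choose t) * f T] (mod int p)"
    using K T assms(2) by (intro cong_const_sum_subsets const) (auto intro: finite_subset)
  with sum[OF K] have "int p dvd int (k choose t) * f T"
    by (metis cong_0_iff cong_sym cong_trans)
  moreover have "\<not> int p dvd int (k choose t)"
    using assms(5) by presburger
  ultimately show ?thesis
    using assms(1) by (metis cong_0_iff prime_dvd_mult_iff prime_nat_int_transfer)
qed

text \<open>Sets of equal size are joined by a chain of single-element swaps. Each swap replaces a
  point of \<open>T - T'\<close> by one of \<open>T' - T\<close>, so \<open>card (T - T')\<close>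
  drops.\<close>

lemma constant_of_exchange:
  assumes "finite V"
    and equiv: "\<And>A. R A A" "\<And>A B C. R A B \<Longrightarrow> R B C \<Longrightarrow> R A C"
    and exch: "\<And>x y S. \<lbrakk>x \<in> V; y \<in> V; x \<noteq> y; S \<subseteq> V - {x, y}; card S = t\<rbrakk>
                 \<Longrightarrow> R (insert x S) (insert y S)"
    and "T \<subseteq> V" "card T = Suc t" "T' \<subseteq> V" "card T' = Suc t"
  shows "R T T'"
  using assms(5-)
proof (induction "card (T - T')" arbitrary: T rule: less_induct)
  case less
  have fin: "finite T" "finite T'"
    using less.prems assms(1) finite_subset by auto
  show ?case
  proof (cases "T = T'")
    case True
    then show ?thesis using equiv by simp
  next
    case False
    have "\<not> T \<subseteq> T'" "\<not> T' \<subseteq> T"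
      using False less.prems fin by (metis card_subset_eq)+
    then obtain x y where xy: "x \<in> T" "x \<notin> T'" "y \<in> T'" "y \<notin> T" by blast
    let ?S = "T - {x}"
    have S: "card ?S = t" "?S \<subseteq> V - {x, y}"
      using xy less.prems fin by auto
    have "R (insert x ?S) (insert y ?S)"
      using xy less.prems S by (intro exch) auto
    moreover have "insert x ?S = T" using xy by auto
    moreover have "R (insert y ?S) T'"
    proof (rule less.hyps)
      have "insert y ?S - T' = (T - T') - {x}" using xy by auto
      then have "insert y ?S - T' \<subset> T - T'" using xy by auto
      then show "card (insert y ?S - T') < card (T - T')"
        using fin psubset_card_mono by blast
      have "y \<notin> ?S" "finite ?S" using xy fin by simp_all
      then show "card (insert y ?S) = Suc t" using S(1) by (metis card_insert_disjoint)
    qed (use xy less.prems in auto)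
    ultimately show ?thesis using equiv by metis
  qed
qed

text \<open>Pascal's rule for sums. Subtracting the instances for two points \<open>x\<close> and
  \<open>y\<close> cancels the sum over subsets of \<open>K\<close> and leaves the sum of
  \<open>f (insert x S) - f (insert y S)\<close>.\<close>

lemma sum_subsets_insert:
  fixes f :: "'a set \<Rightarrow> int"
  assumes "finite K" "x \<notin> K"
  shows "(\<Sum>T | T \<subseteq> insert x K \<and> card T = Suc t. f T) =
         (\<Sum>T | T \<subseteq> K \<and> card T = Suc t. f T) + (\<Sum>S | S \<subseteq> K \<and> card S = t. f (insert x S))"
proof -
  let ?A = "{T. T \<subseteq> K \<and> card T = Suc t}" and ?B = "{S. S \<subseteq> K \<and> card S = t}"
  have split: "{T. T \<subseteq> insert x K \<and> card T = Suc t} = ?A \<union> insert x ` ?B"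
  proof (intro equalityI subsetI)
    fix T assume T: "T \<in> {T. T \<subseteq> insert x K \<and> card T = Suc t}"
    show "T \<in> ?A \<union> insert x ` ?B"
    proof (cases "x \<in> T")
      case True
      then have "T = insert x (T - {x})" by auto
      moreover have "T - {x} \<in> ?B" using T True by auto
      ultimately show ?thesis by blast
    qed (use T in auto)
  next
    fix T assume "T \<in> ?A \<union> insert x ` ?B"
    then show "T \<in> {T. T \<subseteq> insert x K \<and> card T = Suc t}"
      using assms by (auto simp: card_insert_if finite_subset)
  qed
  have "inj_on (insert x) ?B"
    using assms(2) by (auto intro!: inj_onI)
  moreover have "?A \<inter> insert x ` ?B = {}" using assms(2) by auto
  ultimately show ?thesis
    using assms(1) by (simp add: split sum.union_disjoint sum.reindex)
qed

text \<open>Induction on \<open>t\<close>. Removing two points lowers both sides of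
  \<open>k + t \<le> card V\<close> by 2, so the size condition survives.\<close>

lemma inclusion_kernel_constant:
  fixes f :: "'a set \<Rightarrow> int"
  assumes "prime p" "finite V" "t \<le> k" "k + t \<le> card V"
    and "\<And>i. 1 \<le> i \<Longrightarrow> i \<le> t \<Longrightarrow> \<not> p dvd (k - i) choose (t - i)"
    and "\<And>K. K \<subseteq> V \<Longrightarrow> card K = k \<Longrightarrow>
           [(\<Sum>T | T \<subseteq> K \<and> card T = t. f T) = 0] (mod int p)"
    and "T \<subseteq> V" "card T = t" "T' \<subseteq> V" "card T' = t"
  shows "[f T = f T'] (mod int p)"
  using assms(2-)
proof (induction t arbitrary: k V f T T')
  case 0
  then have "T = {}" "T' = {}"
    by (metis card_0_eq finite_subset)+
  then show ?case by simp
next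
  case (Suc t)
  obtain k' where k: "k = Suc k'" using Suc.prems by (cases k) auto
  show ?case
  proof (rule constant_of_exchange[where R = "\<lambda>A B. [f A = f B] (mod int p)"])
    fix x y S assume xy: "x \<in> V" "y \<in> V" "x \<noteq> y" and S: "S \<subseteq> V - {x, y}" "card S = t"
    define g where "g = (\<lambda>S. f (insert x S) - f (insert y S))"
    have fin: "finite (V - {x, y})" using Suc.prems by simp
    have card: "card (V - {x, y}) = card V - 2"
      using xy Suc.prems by (simp add: card_Diff_subset)
    have gsum: "[(\<Sum>S | S \<subseteq> K \<and> card S = t. g S) = 0] (mod int p)"
      if K: "K \<subseteq> V - {x, y}" "card K = k'" for K
    proof -
      have fK: "finite K" "x \<notin> K" "y \<notin> K" using K fin finite_subset by auto
      have "[(\<Sum>T | T \<subseteq> insert z K \<and> card T = Suc t. f T) = 0] (mod int p)"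
        if "z = x \<or> z = y" for z
        using that K fK xy k by (intro Suc.prems) auto
      then have "[(\<Sum>T | T \<subseteq> insert x K \<and> card T = Suc t. f T)
          - (\<Sum>T | T \<subseteq> insert y K \<and> card T = Suc t. f T) = 0 - 0] (mod int p)"
        by (intro cong_diff) auto
      then show ?thesis
        using fK by (simp add: sum_subsets_insert g_def sum_subtractf)
    qed
    \<comment> \<open>The range \<open>1 \<le> i\<close> for \<open>(Suc t, k)\<close> becomes
      \<open>0 \<le> i\<close> for \<open>(t, k')\<close>. The positive indices feed the induction
      hypothesis, making \<open>g\<close> constant; index 0 then makes that constant zero.\<close>
    have nd: "\<not> p dvd (k' - i) choose (t - i)" if "i \<le> t" for i
      using Suc.prems(4)[of "Suc i"] that k by simp
    have "[g S = 0] (mod int p)"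
    proof (rule dvd_of_cong_const[OF assms(1) fin _ _ _ gsum _ S])
      show "t \<le> k'" "k' \<le> card (V - {x, y})"
        using Suc.prems k card by simp_all
      show "\<not> p dvd k' choose t" using nd[of 0] by simp
      show "[g A = g B] (mod int p)"
        if "A \<subseteq> V - {x, y}" "card A = t" "B \<subseteq> V - {x, y}" "card B = t" for A B
        using that Suc.prems k card fin nd gsum by (intro Suc.IH[of "V - {x, y}" k' g]) simp_all
    qed
    then show "[f (insert x S) = f (insert y S)] (mod int p)"
      by (simp add: g_def cong_diff_iff_cong_0)
  qed (use Suc.prems in \<open>auto intro: cong_trans\<close>)
qed

section \<open>Valuations of factors and binomial coefficients prime to \<open>p\<close>\<close>

text \<open>Compares \<open>(M + n) choose n = (\<Prod>j=1..n. (M + j) / j)\<close> factor by factor.\<close>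

lemma not_dvd_choose:
  fixes p :: nat
  assumes "prime p"
    and "\<And>j. 1 \<le> j \<Longrightarrow> j \<le> n \<Longrightarrow> multiplicity p (M + j) = multiplicity p j"
  shows "\<not> p dvd (M + n) choose n"
  using assms(2)
proof (induction n)
  case 0
  then show ?case using assms(1) not_prime_1 by auto
next
  case (Suc n)
  have "Suc n * ((M + Suc n) choose Suc n) = (M + Suc n) * ((M + n) choose n)"
    using Suc_times_binomial_eq[of "M + n" n] by (simp add: mult.commute)
  moreover have "(M + Suc n) choose Suc n \<noteq> 0" "(M + n) choose n \<noteq> 0" by simp_all
  ultimately have "multiplicity p (Suc n) + multiplicity p ((M + Suc n) choose Suc n)
      = multiplicity p (M + Suc n) + multiplicity p ((M + n) choose n)"
    using assms(1) prime_elem_multiplicity_mult_distrib[of p]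
    by (metis Zero_not_Suc add_Suc_right prime_imp_prime_elem)
  moreover have "multiplicity p ((M + n) choose n) = 0"
    using Suc by (simp add: not_dvd_imp_multiplicity_0)
  ultimately have "multiplicity p ((M + Suc n) choose Suc n) = 0"
    using Suc.prems[of "Suc n"] by simp
  then show ?case
    by (metis multiplicity_eq_zero_iff assms(1) \<open>(M + Suc n) choose Suc n \<noteq> 0\<close> not_prime_unit)
qed

text \<open>If \<open>p ^ s\<close> does not divide \<open>j\<close>, adding a multiple of
  \<open>p ^ s\<close> keeps the valuation. Otherwise \<open>j = q * p ^ s\<close>, and since
  \<open>q\<close> and \<open>m + q\<close> are prime to \<open>p\<close>, both valuations equal
  \<open>s\<close>.\<close>

lemma multiplicity_add_power_mult:
  fixes p :: nat
  assumes "prime p" "j > 0" and q: "\<And>q. j = q * p ^ s \<Longrightarrow> \<not> p dvd q \<and> \<not> p dvd m + q"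
  shows "multiplicity p (m * p ^ s + j) = multiplicity p j"
proof (cases "p ^ s dvd j")
  case True
  then obtain q' where q': "j = q' * p ^ s" by (metis dvd_div_mult_self)
  have *: "multiplicity p (a * p ^ s) = s" if "\<not> p dvd a" for a
    using assms(1) that by (intro multiplicity_eqI) auto
  have "m * p ^ s + j = (m + q') * p ^ s" using q' by (simp add: algebra_simps)
  then show ?thesis using * q q' by simp
next
  case False
  \<comment> \<open>For \<open>e > s\<close> both sides are false, because neither number is
    divisible by \<open>p ^ s\<close>.\<close>
  have "p ^ e dvd m * p ^ s + j \<longleftrightarrow> p ^ e dvd j" for e
  proof (cases "e \<le> s")
    case True
    then have "p ^ e dvd m * p ^ s" by (simp add: le_imp_power_dvd)
    then show ?thesis using dvd_add_right_iff by blast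
  next
    case e: False
    then have "p ^ s dvd p ^ e" by (simp add: le_imp_power_dvd)
    moreover have "\<not> p ^ s dvd m * p ^ s + j" using False by (simp add: dvd_add_right_iff)
    ultimately show ?thesis using False dvd_trans by blast
  qed
  then show ?thesis by (simp add: multiplicity_def)
qed

text \<open>As \<open>(k - i) - (t - i) = k - t\<close>, the same shift \<open>m * p ^ s\<close>
  serves every \<open>i\<close>, and only multiples of \<open>p ^ s\<close> up to
  \<open>t - i\<close> have to be checked.\<close>

lemma not_dvd_choose_power_shift:
  fixes p :: nat
  assumes "prime p" "t \<le> k" "k - t = m * p ^ s"
    and "\<And>q. 1 \<le> q \<Longrightarrow> q * p ^ s \<le> t - i \<Longrightarrow> \<not> p dvd q \<and> \<not> p dvd m + q"
    and "i \<le> t"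
  shows "\<not> p dvd (k - i) choose (t - i)"
proof -
  have "\<not> p dvd (m * p ^ s + (t - i)) choose (t - i)"
  proof (intro not_dvd_choose multiplicity_add_power_mult)
    fix j q assume "1 \<le> j" "j \<le> t - i" "j = q * p ^ s"
    then show "\<not> p dvd q \<and> \<not> p dvd m + q"
      using assms(4)[of q] by (cases q) auto
  qed (use assms(1) in auto)
  moreover have "m * p ^ s + (t - i) = k - i" using assms(2,3,5) by linarith
  ultimately show ?thesis by simp
qed

section \<open>From base-\<open>p\<close> digits to nondivisibility\<close>

lemma digit_sum_less:
  fixes p :: nat
  assumes "\<And>i. i < n \<Longrightarrow> d i \<le> p - 1" "p > 0"
  shows "(\<Sum>i<n. d i * p ^ i) < p ^ n"
  using assms(1)
proof (induction n)
  case (Suc n)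
  have "d n * p ^ n \<le> (p - 1) * p ^ n" using Suc.prems by simp
  moreover have "(\<Sum>i<n. d i * p ^ i) < p ^ n" using Suc by simp
  moreover have "p ^ Suc n = (p - 1) * p ^ n + p ^ n"
    using assms(2) by (cases p) simp_all
  ultimately show ?case unfolding sum.lessThan_Suc by linarith
qed simp

lemma higher_digits_dvd:
  fixes p :: nat
  shows "p ^ n dvd (\<Sum>i=n..m. d i * p ^ i)"
proof (rule dvd_sum)
  fix i assume "i \<in> {n..m}"
  then have "p ^ n dvd p ^ i" by (simp add: le_imp_power_dvd)
  then show "p ^ n dvd d i * p ^ i" by (rule dvd_mult)
qed

text \<open>A nonzero leading digit gives \<open>p ^ m \<le> n\<close>, while the digit bound gives
  \<open>n' < p ^ Suc m'\<close>.\<close>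

lemma base_expansion_le_length:
  assumes "p > 0" "base_expansion p n m d" "base_expansion p n' m' d'" "n \<noteq> 0" "n \<le> n'"
  shows "m \<le> m'"
proof (rule ccontr)
  assume "\<not> m \<le> m'"
  have "n' = (\<Sum>i<Suc m'. d' i * p ^ i)"
    using assms(3) by (simp add: base_expansion_def atLeast0AtMost lessThan_Suc_atMost)
  also have "\<dots> < p ^ Suc m'"
    using assms(1,3) by (intro digit_sum_less) (auto simp: base_expansion_def)
  also have "\<dots> \<le> p ^ m" using \<open>\<not> m \<le> m'\<close> assms(1) by (intro power_increasing) auto
  also have "\<dots> \<le> d m * p ^ m" using assms(2,4) by (simp add: base_expansion_def)
  also have "\<dots> \<le> (\<Sum>i=0..m. d i * p ^ i)" by (rule member_le_sum) auto
  also have "\<dots> = n" using assms(2) by (simp add: base_expansion_def)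
  finally show False using assms(5) by simp
qed

text \<open>The common low digits cancel, so \<open>p ^ tp\<close> divides \<open>k - t\<close> with
  quotient congruent to \<open>kd tp - td tp\<close>. For \<open>1 \<le> q \<le> td tp\<close>,
  adding \<open>q\<close> gives a residue between 1 and \<open>kd tp < p\<close>.\<close>

lemma not_dvd_choose_matching_digits:
  assumes p: "prime p" and k: "base_expansion p k kp kd" and t: "base_expansion p t tp td"
    and "t \<le> k" "i \<le> t" and low: "\<forall>i<tp. kd i = td i" and top: "td tp \<le> kd tp"
  shows "\<not> p dvd (k - i) choose (t - i)"
\<comment> \<open>For \<open>t = 0\<close> the index \<open>tp\<close> is arbitrary and may exceed
  \<open>kp\<close>, so this case stands apart.\<close>
proof (cases "t = 0")
  case True
  then show ?thesis using p not_prime_1 by auto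
next
  case False
  have p0: "p > 0" using p prime_gt_0_nat by blast
  have "tp \<le> kp" using base_expansion_le_length[OF p0 t k False \<open>t \<le> k\<close>] .
  define l where "l = (\<Sum>i<tp. td i * p ^ i)"
  have "l < p ^ tp"
    unfolding l_def using t p0 by (intro digit_sum_less) (auto simp: base_expansion_def)
  have teq: "t = l + td tp * p ^ tp"
    using t by (simp add: base_expansion_def l_def atLeast0AtMost flip: lessThan_Suc_atMost)
  obtain r where r: "(\<Sum>i=Suc tp..kp. kd i * p ^ i) = p ^ Suc tp * r"
    using higher_digits_dvd by (metis dvd_def)
  have "k = (\<Sum>i=0..kp. kd i * p ^ i)" using k by (simp add: base_expansion_def)
  also have "\<dots> = (\<Sum>i=0..tp. kd i * p ^ i) + p ^ Suc tp * r"
    using \<open>tp \<le> kp\<close> r sum.ub_add_nat[of 0 tp "\<lambda>i. kd i * p ^ i" "kp - tp"] by simp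
  also have "(\<Sum>i=0..tp. kd i * p ^ i) = l + kd tp * p ^ tp"
    using low by (simp add: l_def atLeast0AtMost flip: lessThan_Suc_atMost)
  finally have keq: "k = l + kd tp * p ^ tp + p ^ Suc tp * r" .
  have kt: "k - t = (kd tp - td tp + p * r) * p ^ tp"
    using top by (simp add: keq teq algebra_simps diff_mult_distrib)
  have kd: "kd tp < p"
  proof -
    have "kd tp \<le> p - 1" using k \<open>tp \<le> kp\<close> by (simp add: base_expansion_def)
    then show ?thesis using p0 by linarith
  qed
  show ?thesis
  proof (rule not_dvd_choose_power_shift[OF p \<open>t \<le> k\<close> kt _ \<open>i \<le> t\<close>])
    fix q assume q: "1 \<le> q" "q * p ^ tp \<le> t - i"
    then have "q * p ^ tp < Suc (td tp) * p ^ tp"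
      using teq \<open>l < p ^ tp\<close> by simp
    then have "q \<le> td tp" by (metis less_Suc_eq_le mult_less_cancel2)
    then have "\<not> p dvd q" "\<not> p dvd kd tp - td tp + q"
      using q top kd by (auto dest!: dvd_imp_le)
    moreover have "kd tp - td tp + p * r + q = kd tp - td tp + q + r * p" by simp
    ultimately show "\<not> p dvd q \<and> \<not> p dvd kd tp - td tp + p * r + q"
      by (metis dvd_add_times_triv_right_iff)
  qed
qed

text \<open>Here \<open>m + q = p * r - (d - q)\<close>, and \<open>1 \<le> i\<close> forces
  \<open>q < d\<close>, so \<open>0 < d - q < p\<close>. At \<open>i = 0\<close> the value
  \<open>q = d\<close> would give the multiple \<open>p * r\<close>.\<close>

lemma not_dvd_choose_power_multiple:
  fixes p :: nat
  assumes p: "prime p" and "p ^ Suc s dvd k" "d < p" and t: "t = d * p ^ s"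
    and "t \<le> k" "1 \<le> i" "i \<le> t"
  shows "\<not> p dvd (k - i) choose (t - i)"
proof -
  have p0: "p > 0" using p prime_gt_0_nat by blast
  obtain r where r: "k = p * r * p ^ s" using assms(2) by (auto simp: dvd_def mult_ac)
  have kt: "k - t = (p * r - d) * p ^ s" by (simp add: r t diff_mult_distrib)
  show ?thesis
  proof (rule not_dvd_choose_power_shift[OF p \<open>t \<le> k\<close> kt _ \<open>i \<le> t\<close>])
    fix q assume q: "1 \<le> q" "q * p ^ s \<le> t - i"
    have "d \<le> p * r" using \<open>t \<le> k\<close> p0 by (simp add: r t)
    have "q * p ^ s < d * p ^ s" using q assms(6,7) t by linarith
    then have "q < d" by simp
    then have "\<not> p dvd d - q" using assms(3) by (auto dest!: dvd_imp_le)
    moreover have "p * r - d + q = p * r - (d - q)" using \<open>d \<le> p * r\<close> \<open>q < d\<close> by simp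
    moreover have "d - q \<le> p * r" using \<open>d \<le> p * r\<close> by simp
    ultimately have "\<not> p dvd p * r - d + q"
      by (metis diff_diff_cancel dvd_diff_nat dvd_triv_left)
    moreover have "\<not> p dvd q" using q \<open>q < d\<close> assms(3) by (auto dest!: dvd_imp_le)
    ultimately show "\<not> p dvd q \<and> \<not> p dvd p * r - d + q" by simp
  qed
qed

section \<open>Back to the set families \<open>U\<close> and \<open>U'\<close>\<close>

lemma sum_indicator_diff_subsets:
  assumes "finite K" "U \<subseteq> {T. T \<subseteq> V \<and> card T = t}" "U' \<subseteq> {T. T \<subseteq> V \<and> card T = t}"
  shows "(\<Sum>T | T \<subseteq> K \<and> card T = t. of_bool (T \<in> U) - of_bool (T \<in> U'))
       = int (card {T \<in> U. T \<subseteq> K}) - int (card {T \<in> U'. T \<subseteq> K})"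
proof -
  have "(\<Sum>T | T \<subseteq> K \<and> card T = t. of_bool (T \<in> W)) = int (card {T \<in> W. T \<subseteq> K})"
    if "W \<subseteq> {T. T \<subseteq> V \<and> card T = t}" for W
  proof -
    have "{T. T \<subseteq> K \<and> card T = t} \<inter> {T. T \<in> W} = {T \<in> W. T \<subseteq> K}" using that by auto
    then show ?thesis using assms(1) by (simp add: sum_of_bool_eq)
  qed
  then show ?thesis using assms by (simp add: sum_subtractf)
qed

theorem theorem1p3:
  fixes p v t k tp kp :: nat
    and td kd :: "nat \<Rightarrow> nat"
    and V :: "'a set"
    and U U' :: "'a set set"
  assumes "prime p"
    and "base_expansion p k kp kd"
    and "base_expansion p t tp td"
    and "finite V" and "card V = v"
    and "int t \<le> min (int k) (int v - int k)"
    and "U \<subseteq> {T. T \<subseteq> V \<and> card T = t}"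
    and "U' \<subseteq> {T. T \<subseteq> V \<and> card T = t}"
    and "\<forall>K. K \<subseteq> V \<and> card K = k \<longrightarrow>
           [card {T \<in> U. T \<subseteq> K} = card {T \<in> U'. T \<subseteq> K}] (mod p)"
  shows "((\<forall>i<tp. kd i = td i) \<and> kd tp \<ge> td tp \<longrightarrow> U = U') \<and>
         (t = td tp * p ^ tp \<and> k = (\<Sum>i=tp+1..kp. kd i * p ^ i) \<longrightarrow>
            U = U' \<or>
            (U = {T. T \<subseteq> V \<and> card T = t} \<and> U' = {}) \<or>
            (U = {} \<and> U' = {T. T \<subseteq> V \<and> card T = t}) \<or>
            (p = 2 \<and> (\<forall>T. T \<subseteq> V \<and> card T = t \<longrightarrow> (T \<in> U \<longleftrightarrow> T \<notin> U'))))"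
proof -
  let ?X = "{T. T \<subseteq> V \<and> card T = t}"
  define f :: "'a set \<Rightarrow> int" where "f = (\<lambda>T. of_bool (T \<in> U) - of_bool (T \<in> U'))"
  have p2: "p \<ge> 2" using assms(1) prime_ge_2_nat by blast
  have tk: "t \<le> k" and kt: "k + t \<le> card V" using assms(5,6) by linarith+
  have sum: "[(\<Sum>T | T \<subseteq> K \<and> card T = t. f T) = 0] (mod int p)"
    if "K \<subseteq> V" "card K = k" for K
    using that assms(4,9) finite_subset[OF that(1)]
    by (simp add: f_def sum_indicator_diff_subsets[OF _ assms(7,8)] cong_diff_iff_cong_0 cong_int_iff)
  have const: "[f T = f T'] (mod int p)"
    if "\<And>i. 1 \<le> i \<Longrightarrow> i \<le> t \<Longrightarrow> \<not> p dvd (k - i) choose (t - i)" "T \<in> ?X" "T' \<in> ?X" for T T'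
    using that by (intro inclusion_kernel_constant[OF assms(1,4) tk kt _ sum]) auto
  \<comment> \<open>The values of \<open>f\<close> lie in -1, 0, 1, so only 0 vanishes modulo
    \<open>p \<ge> 2\<close>.\<close>
  have eqI: "U = U'" if "\<And>T. T \<in> ?X \<Longrightarrow> [f T = 0] (mod int p)"
  proof -
    have "T \<in> U \<longleftrightarrow> T \<in> U'" if "T \<in> ?X" for T
      using \<open>\<And>T. T \<in> ?X \<Longrightarrow> [f T = 0] (mod int p)\<close>[OF that] p2
      by (auto simp: f_def cong_0_iff of_bool_def split: if_splits)
    then show ?thesis using assms(7,8) by blast
  qed
  have vanish: "U = U'" if nd: "\<And>i. i \<le> t \<Longrightarrow> \<not> p dvd (k - i) choose (t - i)"
  proof (rule eqI)
    fix T assume "T \<in> ?X"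
    then show "[f T = 0] (mod int p)"
      using nd[of 0] kt const[OF nd]
      by (intro dvd_of_cong_const[OF assms(1,4) tk _ _ sum]) auto
  qed
  show ?thesis
  proof (intro conjI impI)
    assume "(\<forall>i<tp. kd i = td i) \<and> kd tp \<ge> td tp"
    then show "U = U'"
      using not_dvd_choose_matching_digits[OF assms(1-3) tk] by (intro vanish) blast
  next
    assume H: "t = td tp * p ^ tp \<and> k = (\<Sum>i=tp+1..kp. kd i * p ^ i)"
    have "td tp < p" using assms(3) p2 by (auto simp: base_expansion_def dest: spec[of _ tp])
    moreover have "p ^ Suc tp dvd k" using H higher_digits_dvd[of p "Suc tp"] by simp
    ultimately have nd: "\<not> p dvd (k - i) choose (t - i)" if "1 \<le> i" "i \<le> t" for i
      using that H tk assms(1) by (intro not_dvd_choose_power_multiple) auto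
    obtain T0 where T0: "T0 \<in> ?X"
      using kt obtain_subset_with_card_n[of t V] by auto
    have c: "[f T = f T0] (mod int p)" if "T \<in> ?X" for T
      using const[OF nd that T0] .
    \<comment> \<open>For \<open>p > 2\<close> the values -1, 0, 1 are distinct modulo
      \<open>p\<close>, so \<open>f\<close> is constant as an integer function. For
      \<open>p = 2\<close> the values 1 and -1 merge, and an odd \<open>f T0\<close> only says that
      each \<open>T\<close> lies in exactly one of \<open>U\<close>, \<open>U'\<close>.\<close>
    consider "f T0 = 0" | "f T0 \<noteq> 0" "p = 2" | "f T0 = 1" "p \<noteq> 2" | "f T0 = -1" "p \<noteq> 2"
      by (cases "T0 \<in> U"; cases "T0 \<in> U'"; cases "p = 2") (auto simp: f_def)
    then show "U = U' \<or> (U = ?X \<and> U' = {}) \<or> (U = {} \<and> U' = ?X) \<or>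
        (p = 2 \<and> (\<forall>T. T \<subseteq> V \<and> card T = t \<longrightarrow> (T \<in> U \<longleftrightarrow> T \<notin> U')))"
    proof cases
      case 1
      then show ?thesis using eqI c by simp
    next
      case 2
      have "T \<in> U \<longleftrightarrow> T \<notin> U'" if "T \<in> ?X" for T
        using c[OF that] 2
        by (auto simp: f_def cong_iff_dvd_diff of_bool_def split: if_splits)
      then show ?thesis using 2 by auto
    next
      case 3
      have "T \<in> U \<and> T \<notin> U'" if "T \<in> ?X" for T
        using c[OF that] 3 p2
        by (auto simp: f_def cong_iff_dvd_diff of_bool_def dest!: zdvd_imp_le split: if_splits)
      then show ?thesis using assms(7,8) by blast
    next
      case 4
      have "T \<notin> U \<and> T \<in> U'" if "T \<in> ?X" for T
        using c[OF that] 4 p2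
        by (auto simp: f_def cong_iff_dvd_diff of_bool_def dest!: zdvd_imp_le split: if_splits)
      then show ?thesis using assms(7,8) by blast
    qed
  qed
qed

end
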